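(* Let $f\in\mathcal{U}$ have the expansion $f(z)=z+a_2z^2+a_3z^3+\cdots$. Then (i) $|T_{2,2}(f)|\le 13$; (ii) $|T_{2,3}(f)|\le 25$; (iii) $|T_{3,1}(f)|\le 24$; (iv) $|T_{3,2}(f)|\le 84$; (v) $|T_{3,3}(f)|\le 211.8772\ldots$, i.e. there is an absolute constant $C$ with $211.8772\le C<211.8773$ such that $|T_{3,3}(f)|\le C$ for every $f\in\mathcal{U}$. The inequalities (i)-(iv) are sharp, i.e. for each of them there is a function in $\mathcal{U}$ for which equality holds.
   Context: Let $\mathbb{D}=\{z\in\mathbb{C}:|z|<1\}$ and let $\mathcal{A}$ be the class of analytic functions $f$ in $\mathbb{D}$ with $f(0)=f'(0)-1=0$, i.e. $f(z)=z+a_2z^2+a_3z^3+\cdots$; put $a_1=1$. The class $\mathcal{U}$ consists of all $f\in\mathcal{A}$ such that $$\left|\left(\frac{z}{f(z)}\right)^2 f'(z)-1\right|<1\quad\text{for all } z\in\mathbb{D}$$ (in particular $f(z)\neq 0$ for $0<|z|<1$, and $z/f(z)$ is given the value $1$ at $z=0$). For integers $q,n\ge 1$, the symmetric Toeplitz determinant $T_{q,n}(f)$ is the determinant of the $q\times q$ matrix whose $(i,j)$ entry is $a_{n+|i-j|}$. In particular $T_{2,2}(f)=a_2^2-a_3^2$, $T_{2,3}(f)=a_3^2-a_4^2$, $T_{3,1}(f)=1-2a_2^2+2a_2^2a_3-a_3^2$, $T_{3,2}(f)=(a_2-a_4)(a_2^2-2a_3^2+a_2a_4)$, $T_{3,3}(f)=(a_3-a_5)(a_3^2-2a_4^2+a_3a_5)$.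 *)

theory Defs
  imports "HOL-Complex_Analysis.Complex_Analysis" "Jordan_Normal_Form.Determinant"
begin

definition class_A :: "(complex \<Rightarrow> complex) set" where
  "class_A = {f. f holomorphic_on ball 0 1 \<and> f 0 = 0 \<and> deriv f 0 = 1}"

text \<open>The quotient \<open>z / f z\<close> has a removable singularity at the origin, where its
  value is \<open>1\<close>; HOL's totalised division would give \<open>0\<close> there.\<close>

definition class_U :: "(complex \<Rightarrow> complex) set" where
  "class_U = {f \<in> class_A. \<forall>z \<in> ball 0 1.
     (z \<noteq> 0 \<longrightarrow> f z \<noteq> 0) \<and>
     cmod ((if z = 0 then 1 else z / f z)\<^sup>2 * deriv f z - 1) < 1}"

definition toeplitz_det :: "nat \<Rightarrow> nat \<Rightarrow> (complex \<Rightarrow> complex) \<Rightarrow> complex" where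
  "toeplitz_det q n f = Determinant.det (Matrix.mat q q
     (\<lambda>(i, j). fps_nth (fps_expansion f 0) (n + nat \<bar>int i - int j\<bar>)))"

end

theory Submission
  imports Defs
begin

text \<open>
  For \<open>f\<close> in the class put \<open>h(z) = z / f(z)\<close>. Then \<open>(z / f)\<^sup>2 f' - 1 = h - z h' - 1\<close>, and
  this function, bounded by 1, vanishes to second order at the origin, so it equals
  \<open>z\<^sup>2 g(z)\<close> with \<open>\<bar>g\<bar> \<le> 1\<close>. Two consequences carry the whole proof.

  \<^item> The Taylor coefficients of \<open>h\<close> from order 2 on are those of \<open>g\<close> up to factors
  (\<open>class_U_coefficient_relations\<close>). With \<open>c\<^sub>1\<close>, \<open>c\<^sub>2\<close>, \<open>c\<^sub>3\<close> the coefficients of \<open>g\<close> divided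
  by 1, 2, 3, inverting the series gives \<open>a\<^sub>3\<close>, \<open>a\<^sub>4\<close>, \<open>a\<^sub>5\<close> as polynomials in \<open>a\<^sub>2\<close> and the
  \<open>c\<^sub>i\<close>, while Schur's algorithm bounds the \<open>c\<^sub>i\<close> jointly (\<open>schur_coefficient_bounds\<close>). The
  combinations in the determinants become simple in these variables:
  \<open>a\<^sub>3 - a\<^sub>2\<^sup>2 = c\<^sub>1\<close>, \<open>a\<^sub>2 a\<^sub>4 - a\<^sub>3\<^sup>2 = a\<^sub>2 c\<^sub>2 - c\<^sub>1\<^sup>2\<close> and
  \<open>a\<^sub>3 a\<^sub>5 - a\<^sub>4\<^sup>2 = a\<^sub>3 c\<^sub>3 - 2 a\<^sub>2 c\<^sub>1 c\<^sub>2 + c\<^sub>1\<^sup>3 - c\<^sub>2\<^sup>2\<close>.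

  \<^item> Since \<open>h\<close> has no zeros, it is a square \<open>(1 - \<phi>)\<^sup>2\<close>, and Jack's lemma shows that
  \<open>\<bar>\<phi>\<bar> < 1\<close> (\<open>sqrt_minus_one_in_disc\<close>): at a first point where \<open>\<bar>\<phi>\<bar> = 1\<close> one would have
  \<open>\<bar>h - z h' - 1\<bar> \<ge> 1\<close>. Hence \<open>f(z) = z P(z)\<^sup>2\<close> where \<open>P = 1 / (1 - \<phi>)\<close> has real part above
  one half. The coefficients of such a \<open>P\<close> have modulus at most 1, so \<open>\<bar>a\<^sub>n\<bar> \<le> n\<close>
  (\<open>class_U_coefficient_bound\<close>).

  The \<open>2 \<times> 2\<close> determinants are differences of squares, and the \<open>3 \<times> 3\<close> determinant with
  first row \<open>a, b, c\<close> is \<open>(a - c) ((a\<^sup>2 - b\<^sup>2) + (a c - b\<^sup>2))\<close>, so the triangle inequality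
  reduces all bounds to \<open>\<bar>a\<^sub>n\<bar> \<le> n\<close> and to bounds for the three combinations above. The first
  two combinations have modulus at most 1; for the third one maximises an explicit function of
  \<open>\<bar>c\<^sub>1\<bar>\<close> and \<open>\<bar>c\<^sub>2\<bar>\<close>, whose maximum is \<open>1.48465\<dots>\<close>; this yields \<open>8 (25 + 1.48465\<dots>)\<close>.
  Equality in the four sharp bounds holds for the rotated Koebe function \<open>z / (1 - \<i> z)\<^sup>2\<close>,
  whose coefficients \<open>n \<i>\<^sup>n\<^sup>-\<^sup>1\<close> line up all the signs.
\<close>

section \<open>Schur bounds for bounded analytic functions\<close>

text \<open>
  Schwarz's lemma for the non-strict bound: scaling by \<open>r < 1\<close> makes the bound strict, and
  then \<open>r\<close> tends to 1. Having \<open>\<le>\<close> in both the hypothesis and the conclusion is what allows the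
  division by \<open>z\<close> to be iterated.
\<close>

lemma schwarz_quotient:
  assumes holg: "g holomorphic_on ball 0 1"
    and bound: "\<And>z. cmod z < 1 \<Longrightarrow> cmod (g z) \<le> 1"
    and g0: "g 0 = 0"
  obtains G where "G holomorphic_on ball 0 1"
    and "\<And>z. cmod z < 1 \<Longrightarrow> cmod (G z) \<le> 1"
    and "\<And>z. cmod z < 1 \<Longrightarrow> g z = z * G z"
proof -
  obtain G where holG: "G holomorphic_on ball 0 1"
    and G: "\<And>z. cmod z < 1 \<Longrightarrow> g z = z * G z" and dG: "deriv g 0 = G 0"
    using Schwarz3[OF holg g0] by blast
  have "cmod (G z) \<le> 1" if z: "cmod z < 1" for z
  proof (rule field_le_mult_one_interval)
    fix r :: real assume r: "0 < r" "r < 1"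
    define gr where "gr = (\<lambda>z. of_real r * g z)"
    have holgr: "gr holomorphic_on ball 0 1"
      unfolding gr_def by (intro holomorphic_intros holg)
    have gr0: "gr 0 = 0" by (simp add: gr_def g0)
    have gr_less: "cmod (gr z) < 1" if "cmod z < 1" for z
    proof -
      have "r * cmod (g z) \<le> r * 1"
        using bound[OF that] r by (intro mult_left_mono) auto
      moreover have "cmod (gr z) = r * cmod (g z)" using r by (simp add: gr_def norm_mult)
      ultimately show ?thesis using r by linarith
    qed
    show "r * cmod (G z) \<le> 1"
    proof (cases "z = 0")
      case True
      have "g field_differentiable at 0"
        using holomorphic_on_imp_differentiable_at[OF holg] by simp
      then have "deriv gr 0 = of_real r * G 0"
        by (simp add: gr_def dG)
      then show ?thesis
        using Schwarz_Lemma(2)[OF holgr gr0 gr_less z] True r by (simp add: norm_mult)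
    next
      case False
      have "r * (cmod z * cmod (G z)) \<le> cmod z"
        using Schwarz_Lemma(1)[OF holgr gr0 gr_less z] G[OF z] r
        by (simp add: gr_def norm_mult)
      then have "cmod z * (r * cmod (G z)) \<le> cmod z * 1" by (simp add: algebra_simps)
      moreover have "0 < cmod z" using False by simp
      ultimately show ?thesis by (rule mult_left_le_imp_le)
    qed
  qed
  with holG show ?thesis using G by (rule that)
qed

lemma disc_expansion:
  assumes "g holomorphic_on ball 0 1"
  shows "g has_fps_expansion fps_expansion g 0"
  using assms by (intro has_fps_expansion_fps_expansion[of "ball 0 1"]) auto

lemma disc_expansion_eq:
  fixes F :: "complex fps"
  assumes "f has_fps_expansion F" and "g has_fps_expansion G"
    and "\<And>z. cmod z < 1 \<Longrightarrow> f z = g z"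
  shows "F = G"
proof -
  have "\<forall>\<^sub>F z in nhds 0. z \<in> ball (0::complex) 1"
    by (rule eventually_nhds_in_open) auto
  then have "\<forall>\<^sub>F z in nhds 0. f z = g z"
    by (rule eventually_mono) (use assms(3) in auto)
  then have "f has_fps_expansion G"
    using assms(2) has_fps_expansion_cong by blast
  with assms(1) show ?thesis by (rule fps_expansion_unique_complex)
qed

text \<open>
  Cauchy's estimate on the circle of radius \<open>r\<close> gives the bound \<open>1 / r\<^sup>n\<close>, which
  tends to 1 with \<open>r\<close>.
\<close>

lemma norm_fps_nth_le_1:
  assumes holg: "g holomorphic_on ball 0 1"
    and bound: "\<And>z. cmod z < 1 \<Longrightarrow> cmod (g z) \<le> 1"
    and G: "g has_fps_expansion G"
  shows "cmod (fps_nth G n) \<le> 1"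
proof (rule field_le_mult_one_interval)
  fix s :: real assume s: "0 < s" "s < 1"
  \<comment> \<open>any \<open>r < 1\<close> with \<open>r\<^sup>n \<ge> s\<close> would do; the root of order \<open>n + 1\<close> also covers \<open>n = 0\<close>\<close>
  define r where "r = root (Suc n) s"
  have r: "0 < r" "r < 1" using s by (auto simp: r_def)
  have "r ^ Suc n = s" using s by (simp add: r_def del: power_Suc)
  moreover have "r ^ Suc n \<le> r ^ n" using r by (intro power_decreasing) auto
  ultimately have sr: "s \<le> r ^ n" by simp
  have sub: "cball 0 r \<subseteq> ball (0::complex) 1" "ball 0 r \<subseteq> ball (0::complex) 1"
    using r by auto
  have "cmod ((deriv ^^ n) g 0) \<le> fact n * 1 / r ^ n"
  proof (rule Cauchy_inequality)
    show "g holomorphic_on ball 0 r" using holg sub holomorphic_on_subset by blast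
    show "continuous_on (cball 0 r) g"
      using holg sub holomorphic_on_imp_continuous_on holomorphic_on_subset by blast
    show "0 < r" by fact
    show "\<And>x. cmod (0 - x) = r \<Longrightarrow> cmod (g x) \<le> 1" using bound r by simp
  qed
  moreover have "cmod (fps_nth G n) = cmod ((deriv ^^ n) g 0) / fact n"
    using fps_nth_fps_expansion[OF G, of n] by (simp add: norm_divide)
  ultimately have "r ^ n * cmod (fps_nth G n) \<le> 1"
    using r by (simp add: pos_le_divide_eq pos_divide_le_eq mult.commute)
  moreover have "s * cmod (fps_nth G n) \<le> r ^ n * cmod (fps_nth G n)"
    using sr by (intro mult_right_mono) auto
  ultimately show "s * cmod (fps_nth G n) \<le> 1" by linarith
qed

lemma moebius_norm_le:
  assumes "cmod w \<le> 1" "cmod a \<le> 1"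
  shows "cmod (w - a) \<le> cmod (1 - cnj a * w)"
proof -
  have "(cmod (1 - cnj a * w))\<^sup>2 - (cmod (w - a))\<^sup>2 = (1 - (cmod a)\<^sup>2) * (1 - (cmod w)\<^sup>2)"
    unfolding cmod_power2 by (simp add: power2_eq_square algebra_simps)
  moreover have "0 \<le> (1 - (cmod a)\<^sup>2) * (1 - (cmod w)\<^sup>2)"
    using assms by (intro mult_nonneg_nonneg) (auto simp: power_le_one)
  ultimately have "(cmod (w - a))\<^sup>2 \<le> (cmod (1 - cnj a * w))\<^sup>2" by linarith
  then show ?thesis by (rule power2_le_imp_le) simp
qed

text \<open>
  One step of Schur's algorithm: a disc automorphism moves \<open>g 0\<close> to the origin, and Schwarz's
  lemma then divides out one factor \<open>z\<close>. The relation is stated without the quotient, so that it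
  also covers a unimodular \<open>g 0\<close>: there \<open>g\<close> is constant by the maximum principle, and
  \<open>G = 0\<close> serves.
\<close>

lemma schur_step:
  assumes holg: "g holomorphic_on ball 0 1"
    and bound: "\<And>z. cmod z < 1 \<Longrightarrow> cmod (g z) \<le> 1"
  obtains G where "G holomorphic_on ball 0 1"
    and "\<And>z. cmod z < 1 \<Longrightarrow> cmod (G z) \<le> 1"
    and "\<And>z. cmod z < 1 \<Longrightarrow> g z - g 0 = z * G z * (1 - cnj (g 0) * g z)"
proof (cases "cmod (g 0) = 1")
  case True
  have "g constant_on ball 0 1"
    by (rule maximum_modulus_principle[OF holg, of "ball 0 1" 0]) (use bound True in auto)
  then obtain c where c: "\<And>z. z \<in> ball 0 1 \<Longrightarrow> g z = c" unfolding constant_on_def by blast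
  show ?thesis by (rule that[of "\<lambda>_. 0"]) (simp_all add: c)
next
  case False
  then have g0: "cmod (g 0) < 1" using bound[of 0] by simp
  define k where "k = (\<lambda>z. (g z - g 0) / (1 - cnj (g 0) * g z))"
  have nz: "1 - cnj (g 0) * g z \<noteq> 0" if "cmod z < 1" for z
  proof -
    have "cmod (cnj (g 0) * g z) \<le> cmod (g 0) * 1"
      unfolding norm_mult complex_mod_cnj by (intro mult_left_mono bound that) auto
    then have "cmod (cnj (g 0) * g z) \<noteq> 1" using g0 by linarith
    then show ?thesis by (metis eq_iff_diff_eq_0 norm_one)
  qed
  have holk: "k holomorphic_on ball 0 1"
    unfolding k_def using nz by (intro holomorphic_intros holg) (simp only: mem_ball_0)
  have kle: "cmod (k z) \<le> 1" if "cmod z < 1" for z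
  proof -
    have "cmod (g z - g 0) \<le> cmod (1 - cnj (g 0) * g z)"
      using moebius_norm_le bound[OF that] g0 by simp
    moreover have "0 < cmod (1 - cnj (g 0) * g z)" using nz[OF that] by simp
    ultimately show ?thesis by (simp only: k_def norm_divide divide_le_eq_1_pos)
  qed
  have "k 0 = 0" by (simp add: k_def)
  then obtain G where G: "G holomorphic_on ball 0 1"
      "\<And>z. cmod z < 1 \<Longrightarrow> cmod (G z) \<le> 1" "\<And>z. cmod z < 1 \<Longrightarrow> k z = z * G z"
    using schwarz_quotient[OF holk kle] by metis
  have "g z - g 0 = z * G z * (1 - cnj (g 0) * g z)" if "cmod z < 1" for z
  proof -
    have "g z - g 0 = k z * (1 - cnj (g 0) * g z)" using nz[OF that] by (simp add: k_def)
    then show ?thesis unfolding G(3)[OF that] .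
  qed
  with G(1,2) show ?thesis by (rule that)
qed

lemma schur_step_expansion:
  assumes holg: "g holomorphic_on ball 0 1"
    and bound: "\<And>z. cmod z < 1 \<Longrightarrow> cmod (g z) \<le> 1"
    and C: "g has_fps_expansion C"
  obtains G H where "G holomorphic_on ball 0 1"
    and "\<And>z. cmod z < 1 \<Longrightarrow> cmod (G z) \<le> 1"
    and "G has_fps_expansion H"
    and "C - fps_const (fps_nth C 0) = fps_X * (H * (1 - fps_const (cnj (fps_nth C 0)) * C))"
proof -
  obtain G where G: "G holomorphic_on ball 0 1"
    and Gle: "\<And>z. cmod z < 1 \<Longrightarrow> cmod (G z) \<le> 1"
    and Geq: "\<And>z. cmod z < 1 \<Longrightarrow> g z - g 0 = z * G z * (1 - cnj (g 0) * g z)"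
    using schur_step[OF holg bound] by blast
  have c0: "fps_nth C 0 = g 0"
    using fps_nth_fps_expansion[OF C, of 0] by simp
  have H: "G has_fps_expansion fps_expansion G 0" by (rule disc_expansion[OF G])
  have "(\<lambda>z. g z - g 0) has_fps_expansion C - fps_const (g 0)"
    by (intro fps_expansion_intros C)
  moreover have "(\<lambda>z. z * (G z * (1 - cnj (g 0) * g z))) has_fps_expansion
      fps_X * (fps_expansion G 0 * (1 - fps_const (cnj (g 0)) * C))"
    by (intro fps_expansion_intros C H)
  ultimately have "C - fps_const (g 0) = fps_X * (fps_expansion G 0 * (1 - fps_const (cnj (g 0)) * C))"
    by (rule disc_expansion_eq) (use Geq in \<open>simp add: mult.assoc\<close>)
  with G Gle H show ?thesis unfolding c0[symmetric] by (rule that)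
qed

text \<open>
  The first bound is one Schur step followed by the trivial bound on the constant coefficient
  of the quotient; the second one feeds the first bound, applied to that quotient, into the
  coefficient of order 2 of the same relation.
\<close>

lemma schur_coefficient_bounds:
  assumes holg: "g holomorphic_on ball 0 1"
    and bound: "\<And>z. cmod z < 1 \<Longrightarrow> cmod (g z) \<le> 1"
    and C: "g has_fps_expansion C"
  shows schur_coefficient_bound_1: "cmod (fps_nth C 1) \<le> 1 - (cmod (fps_nth C 0))\<^sup>2"
    and schur_coefficient_bound_2: "cmod (fps_nth C 2) \<le> 1 - (cmod (fps_nth C 0))\<^sup>2
           - (cmod (fps_nth C 1))\<^sup>2 / (1 + cmod (fps_nth C 0))"
proof -
  have first: "cmod (fps_nth C' 1) \<le> 1 - (cmod (fps_nth C' 0))\<^sup>2"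
    if g': "g' holomorphic_on ball 0 1" "\<And>z. cmod z < 1 \<Longrightarrow> cmod (g' z) \<le> 1"
      "g' has_fps_expansion C'" for g' C'
  proof -
    obtain G H where G: "G holomorphic_on ball 0 1" "\<And>z. cmod z < 1 \<Longrightarrow> cmod (G z) \<le> 1"
        "G has_fps_expansion H"
      and rec: "C' - fps_const (fps_nth C' 0) = fps_X * (H * (1 - fps_const (cnj (fps_nth C' 0)) * C'))"
      using schur_step_expansion[OF g'] by blast
    have c: "fps_nth C' 1 = fps_nth H 0 * (1 - cnj (fps_nth C' 0) * fps_nth C' 0)"
      using arg_cong[OF rec, of "\<lambda>F. fps_nth F 1"] by simp
    have sq: "1 - cnj (fps_nth C' 0) * fps_nth C' 0 = of_real (1 - (cmod (fps_nth C' 0))\<^sup>2)"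
      using complex_norm_square[of "fps_nth C' 0"] by (simp add: mult.commute)
    have "0 \<le> 1 - (cmod (fps_nth C' 0))\<^sup>2"
      using norm_fps_nth_le_1[OF g', of 0] by (simp add: power_le_one)
    moreover have "cmod (fps_nth C' 1) = cmod (fps_nth H 0) * \<bar>1 - (cmod (fps_nth C' 0))\<^sup>2\<bar>"
      unfolding c sq norm_mult norm_of_real ..
    ultimately show ?thesis
      using norm_fps_nth_le_1[OF G, of 0] by (simp add: mult_left_le_one_le)
  qed
  show "cmod (fps_nth C 1) \<le> 1 - (cmod (fps_nth C 0))\<^sup>2"
    by (rule first[OF assms])
  obtain G H where G: "G holomorphic_on ball 0 1" "\<And>z. cmod z < 1 \<Longrightarrow> cmod (G z) \<le> 1"
      "G has_fps_expansion H"
    and rec: "C - fps_const (fps_nth C 0) = fps_X * (H * (1 - fps_const (cnj (fps_nth C 0)) * C))"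
    using schur_step_expansion[OF assms] by blast
  define x where "x = cmod (fps_nth C 0)"
  define y where "y = cmod (fps_nth H 0)"
  have x: "0 \<le> x" "x \<le> 1" using norm_fps_nth_le_1[OF assms, of 0] by (auto simp: x_def)
  have sq: "1 - cnj (fps_nth C 0) * fps_nth C 0 = of_real (1 - x\<^sup>2)"
    using complex_norm_square[of "fps_nth C 0"] by (simp add: mult.commute x_def)
  have x2: "0 \<le> 1 - x\<^sup>2" using x by (simp add: power_le_one)
  have c1: "fps_nth C 1 = fps_nth H 0 * (1 - cnj (fps_nth C 0) * fps_nth C 0)"
    using arg_cong[OF rec, of "\<lambda>F. fps_nth F 1"] by simp
  have n1: "cmod (fps_nth C 1) = y * (1 - x\<^sup>2)"
    using x2 unfolding c1 sq norm_mult norm_of_real y_def by simp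
  have c2: "fps_nth C 2 = fps_nth H 1 * (1 - cnj (fps_nth C 0) * fps_nth C 0)
      - fps_nth H 0 * (cnj (fps_nth C 0) * fps_nth C 1)"
    using arg_cong[OF rec, of "\<lambda>F. fps_nth F 2"]
    by (simp add: fps_mult_nth numeral_2_eq_2 algebra_simps)
  have "cmod (fps_nth C 2) \<le> cmod (fps_nth H 1 * (1 - cnj (fps_nth C 0) * fps_nth C 0))
      + cmod (fps_nth H 0 * (cnj (fps_nth C 0) * fps_nth C 1))"
    unfolding c2 by (rule norm_triangle_ineq4)
  also have "\<dots> = cmod (fps_nth H 1) * (1 - x\<^sup>2) + y * (x * (y * (1 - x\<^sup>2)))"
    using x2 unfolding sq norm_mult norm_of_real n1 by (simp add: x_def y_def)
  also have "\<dots> \<le> (1 - y\<^sup>2) * (1 - x\<^sup>2) + y * (x * (y * (1 - x\<^sup>2)))"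
    using first[OF G] x2 by (intro add_right_mono mult_right_mono) (auto simp: y_def)
  also have "\<dots> = 1 - x\<^sup>2 - (y * (1 - x\<^sup>2))\<^sup>2 / (1 + x)"
  proof -
    have "(y * (1 - x\<^sup>2))\<^sup>2 = y\<^sup>2 * (1 - x) * (1 - x\<^sup>2) * (1 + x)"
      by (simp add: power2_eq_square algebra_simps)
    then have "(y * (1 - x\<^sup>2))\<^sup>2 / (1 + x) = y\<^sup>2 * (1 - x) * (1 - x\<^sup>2)" using x by simp
    then show ?thesis by (simp add: power2_eq_square algebra_simps)
  qed
  finally show "cmod (fps_nth C 2) \<le> 1 - (cmod (fps_nth C 0))\<^sup>2
           - (cmod (fps_nth C 1))\<^sup>2 / (1 + cmod (fps_nth C 0))"
    unfolding n1 x_def .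
qed

section \<open>Coefficients of functions with values in a half-plane\<close>

text \<open>
  Inversion maps the half-plane \<open>Re w > 1/2\<close> onto the disc of radius 1 about 1; the converse
  inclusion is \<open>half_lt_Re_inverse\<close> below.
\<close>

lemma norm_one_minus_inverse_less_1:
  assumes "Re w > 1/2"
  shows "cmod (1 - inverse w) < 1"
proof -
  have "w \<noteq> 0" using assms by (cases "w = 0") simp_all
  have "(cmod (w - 1))\<^sup>2 < (cmod w)\<^sup>2"
    using assms unfolding cmod_power2 by (simp add: power2_eq_square algebra_simps)
  then have "cmod (w - 1) < cmod w" by (rule power2_less_imp_less) (rule norm_ge_zero)
  moreover have "1 - inverse w = (w - 1) / w" using \<open>w \<noteq> 0\<close> by (simp add: field_simps)
  ultimately show ?thesis using \<open>w \<noteq> 0\<close> by (simp add: norm_divide)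
qed

text \<open>
  Rogosinski's averaging argument. Averaging \<open>P\<close> over the rotations by the \<open>n\<close>-th roots of
  unity keeps the half-plane condition and the coefficient of order \<open>n\<close>, but kills those of orders
  \<open>1, \<dots>, n - 1\<close>. Therefore \<open>1 - 1 / Q\<close>, which maps the disc into itself, has the same
  coefficient of order \<open>n\<close> as the average \<open>Q\<close>, and Cauchy's estimate applies.
\<close>

lemma half_plane_coefficient_bound:
  assumes holP: "P holomorphic_on ball 0 1"
    and P0: "P 0 = 1"
    and RP: "\<And>z. cmod z < 1 \<Longrightarrow> Re (P z) > 1/2"
    and p: "P has_fps_expansion p"
  shows "cmod (fps_nth p n) \<le> 1"
proof (cases "n = 0")
  case True
  then show ?thesis using fps_nth_fps_expansion[OF p, of 0] P0 by simp
next
  case False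
  then have n: "0 < n" by simp
  define w where "w = cis (2 * pi / n)"
  have w_norm: "cmod w = 1" by (simp add: w_def)
  define Q where "Q = (\<lambda>z. of_real (1 / n) * (\<Sum>k<n. P (w ^ k * z)))"
  define q where "q = fps_const (of_real (1 / n)) *
    (\<Sum>k<n. fps_compose p (fps_const (w ^ k) * fps_X))"
  have q: "Q has_fps_expansion q"
  proof -
    have "(\<lambda>z. P (w ^ k * z)) has_fps_expansion fps_compose p (fps_const (w ^ k) * fps_X)" for k
    proof -
      have "(\<lambda>z. w ^ k * z) has_fps_expansion fps_const (w ^ k) * fps_X"
        by (intro fps_expansion_intros)
      from has_fps_expansion_compose[OF p this] show ?thesis by (simp add: o_def)
    qed
    then show ?thesis unfolding Q_def q_def by (intro fps_expansion_intros)
  qed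
  have holQ: "Q holomorphic_on ball 0 1"
  proof -
    have "(\<lambda>z. P (w ^ k * z)) holomorphic_on ball 0 1" for k
      by (rule holomorphic_on_compose_gen[OF _ holP, unfolded o_def])
        (auto intro!: holomorphic_intros simp: norm_mult norm_power w_norm)
    then show ?thesis unfolding Q_def by (intro holomorphic_intros)
  qed
  have RQ: "Re (Q z) > 1/2" if "cmod z < 1" for z
  proof -
    have "(\<Sum>k<n. 1/2) < (\<Sum>k<n. Re (P (w ^ k * z)))"
      using n that by (intro sum_strict_mono RP) (auto simp: norm_mult norm_power w_norm)
    moreover have "Re (Q z) = (1 / n) * (\<Sum>k<n. Re (P (w ^ k * z)))"
      by (simp add: Q_def Re_sum)
    ultimately show ?thesis using n by (simp add: pos_less_divide_eq)
  qed
  have q_nth: "fps_nth q j = of_real (1 / n) * (\<Sum>k<n. (w ^ j) ^ k) * fps_nth p j" for j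
  proof -
    have "fps_nth q j = of_real (1 / n) * (\<Sum>k<n. (w ^ k) ^ j * fps_nth p j)"
      by (simp add: q_def fps_sum_nth fps_compose_linear del: of_real_divide)
    also have "\<dots> = of_real (1 / n) * (\<Sum>k<n. (w ^ j) ^ k) * fps_nth p j"
      by (simp add: sum_distrib_right power_mult[symmetric] mult.commute[of j])
    finally show ?thesis .
  qed
  have w_pow: "w ^ j = 1 \<longleftrightarrow> n dvd j" for j
  proof -
    have "w ^ j = cis (real j * (2 * pi / n))" unfolding w_def by (rule Complex.DeMoivre)
    then show ?thesis
      using complex_root_unity_eq_1[of n j] n by (simp add: cis_conv_exp mult_ac)
  qed
  then have wn: "w ^ n = 1" by simp
  have qn: "fps_nth q n = fps_nth p n" using n by (simp add: q_nth wn)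
  have q0: "fps_nth q 0 = 1"
    using n fps_nth_fps_expansion[OF p, of 0] P0 by (simp add: q_nth)
  have qz: "fps_nth q j = 0" if j: "0 < j" "j < n" for j
  proof -
    have "w ^ j \<noteq> 1" using j by (auto simp: w_pow dest: dvd_imp_le)
    moreover have "(w ^ j) ^ n = 1" by (metis wn power_mult mult.commute power_one)
    ultimately have "(\<Sum>k<n. (w ^ j) ^ k) = 0" by (simp add: geometric_sum)
    then show ?thesis by (simp add: q_nth)
  qed
  define s where "s = (\<lambda>z. 1 - inverse (Q z))"
  have Qnz: "Q z \<noteq> 0" if "cmod z < 1" for z using RQ[OF that] by auto
  have hols: "s holomorphic_on ball 0 1"
    unfolding s_def using Qnz by (intro holomorphic_intros holQ) auto
  have sle: "cmod (s z) \<le> 1" if "cmod z < 1" for z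
    using norm_one_minus_inverse_less_1[OF RQ[OF that]] by (simp add: s_def)
  define S where "S = fps_expansion s 0"
  have S: "s has_fps_expansion S" unfolding S_def by (rule disc_expansion[OF hols])
  have rel: "S * q = q - 1"
  proof (rule disc_expansion_eq)
    show "(\<lambda>z. s z * Q z) has_fps_expansion S * q" by (intro fps_expansion_intros S q)
    show "(\<lambda>z. Q z - 1) has_fps_expansion q - 1" by (intro fps_expansion_intros q)
    show "s z * Q z = Q z - 1" if "cmod z < 1" for z
      using Qnz[OF that] by (simp add: s_def algebra_simps)
  qed
  have S0: "fps_nth S 0 = 0"
    using arg_cong[OF rel, of "\<lambda>F. fps_nth F 0"] q0 by simp
  have "fps_nth (S * q) n = (\<Sum>i\<in>{0..n}. fps_nth S i * fps_nth q (n - i))"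
    by (rule fps_mult_nth)
  also have "\<dots> = (\<Sum>i\<in>{n}. fps_nth S i * fps_nth q (n - i))"
  proof (intro sum.mono_neutral_right ballI)
    fix i assume "i \<in> {0..n} - {n}"
    then show "fps_nth S i * fps_nth q (n - i) = 0"
      using S0 qz[of "n - i"] by (cases "i = 0") auto
  qed auto
  finally have "fps_nth S n = fps_nth p n" using rel q0 qn n by simp
  then show ?thesis using norm_fps_nth_le_1[OF hols sle S, of n] by simp
qed

lemma half_lt_Re_inverse:
  assumes "cmod (1 - w) < 1"
  shows "1/2 < Re (inverse w)"
proof -
  have "(cmod (1 - w))\<^sup>2 < 1\<^sup>2" using assms by (intro power_strict_mono) auto
  then have "(Re w)\<^sup>2 + (Im w)\<^sup>2 < 2 * Re w"
    unfolding cmod_power2 by (simp add: power2_eq_square algebra_simps)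
  moreover have "0 < (Re w)\<^sup>2 + (Im w)\<^sup>2"
  proof -
    have "w \<noteq> 0" using assms by (cases "w = 0") simp_all
    then show ?thesis using cmod_power2[of w] by (metis zero_less_power2 norm_eq_zero)
  qed
  ultimately show ?thesis by (simp add: inverse_complex.sel(1) pos_less_divide_eq)
qed

section \<open>Jack's lemma and the square root of the reciprocal\<close>

text \<open>
  Jack's lemma. By Schwarz's lemma \<open>\<psi>(u) = \<phi>(z\<^sub>0 u) / \<phi>(z\<^sub>0)\<close> satisfies
  \<open>\<bar>\<psi>(u)\<bar> \<le> \<bar>u\<bar>\<close>, with \<open>\<psi>(1) = 1\<close>. Comparing both sides to first order along every ray
  that enters the disc at 1 shows that \<open>Re (v (D - 1)) \<le> 0\<close> for the derivative \<open>D = \<psi>'(1)\<close> and all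
  \<open>v\<close> in the left half-plane, which forces \<open>D - 1\<close> to be real and nonnegative.
\<close>

lemma jack_boundary_derivative:
  assumes hol: "\<phi> holomorphic_on ball 0 1"
    and zero: "\<phi> 0 = 0"
    and z0: "cmod z0 < 1"
    and bound: "\<And>z. cmod z < cmod z0 \<Longrightarrow> cmod (\<phi> z) \<le> 1"
    and touch: "cmod (\<phi> z0) = 1"
  obtains m :: real where "1 \<le> m" and "z0 * deriv \<phi> z0 = of_real m * \<phi> z0"
proof -
  have z0nz: "z0 \<noteq> 0" using touch zero by auto
  have pnz: "\<phi> z0 \<noteq> 0" using touch by auto
  define \<psi> where "\<psi> = (\<lambda>u. \<phi> (z0 * u) / \<phi> z0)"
  define D where "D = z0 * deriv \<phi> z0 / \<phi> z0"
  have psi_le: "cmod (\<psi> u) \<le> cmod u" if u: "cmod u < 1" for u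
  proof -
    have small: "cmod (z0 * u) < cmod z0" if "cmod u < 1" for u
      using that z0nz by (simp add: norm_mult)
    have "(\<lambda>u. \<phi> (z0 * u)) holomorphic_on ball 0 1"
    proof (rule holomorphic_on_compose_gen[OF _ hol, unfolded o_def])
      show "(*) z0 holomorphic_on ball 0 1" by (intro holomorphic_intros)
      show "(*) z0 ` ball 0 1 \<subseteq> ball 0 1"
        using small z0 by (force intro: less_trans)
    qed
    moreover have "cmod (\<phi> (z0 * u)) \<le> 1" if "cmod u < 1" for u
      by (rule bound) (rule small[OF that])
    ultimately obtain G where "\<And>u. cmod u < 1 \<Longrightarrow> cmod (G u) \<le> 1"
        "\<And>u. cmod u < 1 \<Longrightarrow> \<phi> (z0 * u) = u * G u"
      using schwarz_quotient[of "\<lambda>u. \<phi> (z0 * u)"] zero by (metis mult_zero_right)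
    then show ?thesis
      using u touch by (simp add: \<psi>_def norm_divide norm_mult mult_left_le)
  qed
  have dphi: "(\<phi> has_field_derivative deriv \<phi> z0) (at z0)"
    using hol z0 by (intro holomorphic_derivI[of _ "ball 0 1"]) auto
  have dpsi: "(\<psi> has_field_derivative D) (at 1)"
  proof -
    have "((\<lambda>u. z0 * u) has_field_derivative z0) (at 1)"
      using DERIV_cmult_Id[of z0] by simp
    then have "((\<lambda>u. \<phi> (z0 * u)) has_field_derivative deriv \<phi> z0 * z0) (at 1)"
      by (intro DERIV_chain2[of \<phi>]) (simp_all add: dphi)
    from DERIV_cdivide[OF this, of "\<phi> z0"] show ?thesis
      by (simp add: \<psi>_def D_def mult.commute)
  qed
  have psi1: "\<psi> 1 = 1" using pnz by (simp add: \<psi>_def)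
  have dir: "Re (v * D) \<le> Re v" if v: "Re v < 0" for v
  proof (rule ccontr)
    assume neg: "\<not> Re (v * D) \<le> Re v"
    define c where "c = (cmod v)\<^sup>2 / 2"
    \<comment> \<open>\<open>F s \<le> 0\<close> for small \<open>s > 0\<close>, because \<open>Re \<psi>(u) \<le> \<bar>u\<bar> \<le> (1 + \<bar>u\<bar>\<^sup>2) / 2\<close> and the subtracted term is the last expression at \<open>u = 1 + s v\<close>\<close>
    define F where "F = (\<lambda>s::real. Re (\<psi> (1 + of_real s * v)) - (1 + s * Re v + s\<^sup>2 * c))"
    have "((\<lambda>s::real. 1 + of_real s * v) has_vector_derivative v) (at 0)"
      by (auto intro!: derivative_eq_intros)
    from field_vector_diff_chain_at[OF this, of \<psi> D]
    have "((\<lambda>s::real. \<psi> (1 + of_real s * v)) has_vector_derivative v * D) (at 0)"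
      using dpsi by (simp add: o_def)
    then have "((\<lambda>s::real. Re (\<psi> (1 + of_real s * v))) has_field_derivative Re (v * D)) (at 0)"
      by (rule has_field_derivative_Re)
    moreover have "((\<lambda>s::real. 1 + s * Re v + s\<^sup>2 * c) has_field_derivative Re v) (at 0)"
      by (auto intro!: derivative_eq_intros)
    ultimately have "(F has_field_derivative (Re (v * D) - Re v)) (at 0)"
      unfolding F_def by (rule DERIV_diff)
    then obtain d where d: "0 < d" "\<And>s. 0 < s \<Longrightarrow> s < d \<Longrightarrow> F 0 < F s"
      using DERIV_pos_inc_right[of F "Re (v * D) - Re v" 0] neg by auto
    have F0: "F 0 = 0" by (simp add: F_def psi1)
    have c: "0 < c" using v by (auto simp: c_def)
    \<comment> \<open>small enough for \<open>u = 1 + s v\<close> to lie in the disc\<close>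
    define s where "s = min (d / 2) (- Re v / (2 * c))"
    have s: "0 < s" "s < d" using d(1) c v by (auto simp: s_def divide_neg_pos)
    have "s * (2 * c) \<le> - Re v / (2 * c) * (2 * c)"
      using c by (intro mult_right_mono) (auto simp: s_def)
    then have "s * (2 * c) \<le> - Re v" using c by simp
    then have sc: "s * c < - Re v" using v by simp
    define u where "u = 1 + of_real s * v"
    have u2: "(cmod u)\<^sup>2 = 1 + 2 * (s * Re v + s\<^sup>2 * c)"
      unfolding u_def c_def cmod_power2 by (simp add: power2_eq_square algebra_simps)
    have "s * Re v + s\<^sup>2 * c = s * (Re v + s * c)" by (simp add: power2_eq_square algebra_simps)
    also have "\<dots> < 0" using s(1) sc by (intro mult_pos_neg) auto
    finally have "(cmod u)\<^sup>2 < 1" unfolding u2 by simp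
    then have "cmod u < 1" by (simp add: power_less_one_iff abs_square_less_1)
    then have "Re (\<psi> u) \<le> cmod u" using psi_le[of u] complex_Re_le_cmod[of "\<psi> u"] by linarith
    also have "cmod u \<le> (1 + (cmod u)\<^sup>2) / 2"
      using zero_le_power2[of "cmod u - 1"] by (simp add: power2_eq_square algebra_simps)
    finally have "F s \<le> 0" unfolding u2 by (simp add: F_def u_def)
    with d(2)[OF s] F0 show False by simp
  qed
  have ReD: "1 \<le> Re D" using dir[of "-1"] by simp
  have "Im D = 0"
  proof (rule ccontr)
    assume "Im D \<noteq> 0"
    \<comment> \<open>along this direction \<open>Re (v D) = 0\<close>, which exceeds \<open>Re v = -1\<close>\<close>
    then show False using dir[of "Complex (-1) (- Re D / Im D)"] by simp
  qed
  then have "D = of_real (Re D)" by (simp add: complex_eq_iff)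
  then have "z0 * deriv \<phi> z0 = of_real (Re D) * \<phi> z0"
    using pnz by (metis D_def nonzero_divide_eq_eq)
  with ReD show ?thesis by (rule that)
qed

text \<open>
  At a point of smallest modulus where \<open>\<bar>\<phi>\<bar> = 1\<close>, Jack's lemma gives
  \<open>z \<phi>'(z) = m \<phi>(z)\<close> with \<open>m \<ge> 1\<close>. Substituting this into \<open>h = (1 - \<phi>)\<^sup>2\<close> yields
  \<open>h - z h' - 1 = \<phi> (2 (m - 1) - (2 m - 1) \<phi>)\<close>, whose modulus is at least
  \<open>(2 m - 1) - 2 (m - 1) = 1\<close>.
\<close>

lemma sqrt_minus_one_in_disc:
  assumes holh: "h holomorphic_on ball 0 1"
    and nz: "\<And>z. cmod z < 1 \<Longrightarrow> h z \<noteq> 0"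
    and h0: "h 0 = 1"
    and W: "\<And>z. cmod z < 1 \<Longrightarrow> cmod (h z - z * deriv h z - 1) < 1"
  obtains \<phi> where "\<phi> holomorphic_on ball 0 1" and "\<phi> 0 = 0"
    and "\<And>z. cmod z < 1 \<Longrightarrow> cmod (\<phi> z) < 1"
    and "\<And>z. cmod z < 1 \<Longrightarrow> h z = (1 - \<phi> z)\<^sup>2"
proof -
  have "simply_connected (ball (0::complex) 1)"
    by (rule convex_imp_simply_connected) simp
  then obtain s where hols: "s holomorphic_on ball 0 1"
    and s: "\<forall>z\<in>ball 0 1. h z = (s z)\<^sup>2"
    using holh nz by (subst (asm) simply_connected_eq_holomorphic_sqrt) auto
  \<comment> \<open>the factor \<open>s 0\<close>, which is \<open>1\<close> or \<open>-1\<close>, selects the branch of the root with value 1 at the origin\<close>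
  define \<phi> where "\<phi> = (\<lambda>z. 1 - s 0 * s z)"
  have s0: "s 0 * s 0 = 1" using s h0 by (simp add: power2_eq_square)
  have hol: "\<phi> holomorphic_on ball 0 1"
    unfolding \<phi>_def by (intro holomorphic_intros hols)
  have zero: "\<phi> 0 = 0" by (simp add: \<phi>_def s0)
  have heq: "h z = (1 - \<phi> z)\<^sup>2" if "cmod z < 1" for z
    using s s0 that by (simp add: \<phi>_def power2_eq_square)
  have "cmod (\<phi> z1) < 1" if z1: "cmod z1 < 1" for z1
  proof (rule ccontr)
    assume "\<not> cmod (\<phi> z1) < 1"
    then have ge: "1 \<le> cmod (\<phi> z1)" by simp
    define K where "K = cball 0 (cmod z1) \<inter> (\<lambda>z. cmod (\<phi> z)) -` {1..}"
    have cont: "continuous_on (cball 0 (cmod z1)) (\<lambda>z. cmod (\<phi> z))"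
      using z1 by (intro continuous_intros holomorphic_on_imp_continuous_on holomorphic_on_subset[OF hol]) auto
    have "closed K"
      unfolding K_def by (rule continuous_closed_preimage[OF cont]) auto
    moreover have "bounded K" unfolding K_def by (rule bounded_subset[OF bounded_cball]) auto
    ultimately have "compact K" by (simp add: compact_eq_bounded_closed)
    moreover have "K \<noteq> {}" using ge by (auto simp: K_def)
    ultimately obtain z0 where z0K: "z0 \<in> K" and z0min: "\<And>y. y \<in> K \<Longrightarrow> cmod z0 \<le> cmod y"
      using continuous_attains_inf[of K cmod] by (auto intro: continuous_intros)
    have z0: "cmod z0 < 1" "cmod z0 \<le> cmod z1" "1 \<le> cmod (\<phi> z0)"
      using z0K z1 by (auto simp: K_def)
    have inside: "cmod (\<phi> z) < 1" if "cmod z < cmod z0" for z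
    proof (rule ccontr)
      assume "\<not> cmod (\<phi> z) < 1"
      then have "z \<in> K" using that z0 by (simp add: K_def)
      then show False using z0min that by fastforce
    qed
    have touch: "cmod (\<phi> z0) = 1"
    proof -
      have "continuous_on {0..1} (\<lambda>t::real. cmod (\<phi> (of_real t * z0)))"
      proof (rule continuous_on_compose2[OF cont])
        show "continuous_on {0..1} (\<lambda>t::real. of_real t * z0)" by (intro continuous_intros)
        show "(\<lambda>t::real. of_real t * z0) ` {0..1} \<subseteq> cball 0 (cmod z1)"
          using z0(2) by (auto simp: norm_mult intro: order_trans[OF mult_left_le_one_le[OF norm_ge_zero]])
      qed
      \<comment> \<open>a value above 1 at \<open>z0\<close> would mean a point of \<open>K\<close> earlier on the segment from 0\<close>
      then obtain t :: real where t: "0 \<le> t" "t \<le> 1" "cmod (\<phi> (of_real t * z0)) = 1"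
        using IVT'[of "\<lambda>t::real. cmod (\<phi> (of_real t * z0))" 0 1 1] z0 zero by auto
      have "t = 1"
      proof (rule ccontr)
        assume "t \<noteq> 1"
        moreover have "z0 \<noteq> 0" using z0(3) zero by auto
        ultimately have "cmod (of_real t * z0) < cmod z0" using t by (simp add: norm_mult)
        then show False using inside t by fastforce
      qed
      then show ?thesis using t by simp
    qed
    obtain m :: real where m: "1 \<le> m" "z0 * deriv \<phi> z0 = of_real m * \<phi> z0"
      using jack_boundary_derivative[OF hol zero z0(1) less_imp_le[OF inside] touch] by blast
    have "(\<phi> has_field_derivative deriv \<phi> z0) (at z0)"
      using hol z0 by (intro holomorphic_derivI[of _ "ball 0 1"]) auto
    then have "((\<lambda>z. (1 - \<phi> z)\<^sup>2) has_field_derivative - (2 * (1 - \<phi> z0) * deriv \<phi> z0)) (at z0)"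
      by (auto intro!: derivative_eq_intros)
    then have "(h has_field_derivative - (2 * (1 - \<phi> z0) * deriv \<phi> z0)) (at z0)"
      by (rule has_field_derivative_transform_within_open[of _ _ _ "ball 0 1"]) (use heq z0 in auto)
    then have "deriv h z0 = - (2 * (1 - \<phi> z0) * deriv \<phi> z0)" by (rule DERIV_imp_deriv)
    then have "h z0 - z0 * deriv h z0 - 1 = (1 - \<phi> z0)\<^sup>2 + 2 * (1 - \<phi> z0) * (z0 * deriv \<phi> z0) - 1"
      using heq z0 by simp
    also have "\<dots> = \<phi> z0 * (of_real (2 * (m - 1)) - of_real (2 * m - 1) * \<phi> z0)"
      unfolding m(2) by (simp add: power2_eq_square algebra_simps)
    finally have eq: "cmod (h z0 - z0 * deriv h z0 - 1)
        = cmod (of_real (2 * (m - 1)) - of_real (2 * m - 1) * \<phi> z0)"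
      using touch by (simp only: norm_mult mult_1)
    define A B where "A = of_real (2 * m - 1) * \<phi> z0" and "B = complex_of_real (2 * (m - 1))"
    have "cmod A = 2 * m - 1"
      unfolding A_def norm_mult norm_of_real touch using m(1) by simp
    moreover have "cmod B = 2 * (m - 1)"
      unfolding B_def norm_of_real using m(1) by simp
    ultimately have "1 = cmod A - cmod B" by simp
    also have "\<dots> \<le> cmod (A - B)" by (rule norm_triangle_ineq2)
    also have "\<dots> = cmod (B - A)" by (rule norm_minus_commute)
    finally have "1 \<le> cmod (B - A)" .
    then show False using W[OF z0(1)] eq by (simp only: A_def B_def)
  qed
  with hol zero show ?thesis using heq by (rule that)
qed

section \<open>Coefficients of functions in the class\<close>

text \<open>
  Membership in the class in terms of \<open>h(z) = z / f(z)\<close> alone, using the identity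
  \<open>(z / f)\<^sup>2 f' = h - z h'\<close>.
\<close>

lemma class_U_reciprocal:
  assumes "f \<in> class_U"
  obtains h where "h holomorphic_on ball 0 1"
    and "\<And>z. cmod z < 1 \<Longrightarrow> h z \<noteq> 0" and "h 0 = 1"
    and "\<And>z. cmod z < 1 \<Longrightarrow> f z * h z = z"
    and "\<And>z. cmod z < 1 \<Longrightarrow> cmod (h z - z * deriv h z - 1) < 1"
proof -
  have holf: "f holomorphic_on ball 0 1" and f0: "f 0 = 0" and f1: "deriv f 0 = 1"
    and fnz: "\<And>z. cmod z < 1 \<Longrightarrow> z \<noteq> 0 \<Longrightarrow> f z \<noteq> 0"
    and U: "\<And>z. cmod z < 1 \<Longrightarrow> cmod ((if z = 0 then 1 else z / f z)\<^sup>2 * deriv f z - 1) < 1"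
    using assms by (auto simp: class_U_def class_A_def)
  obtain k where holk: "k holomorphic_on ball 0 1"
    and k: "\<And>z. cmod z < 1 \<Longrightarrow> f z = z * k z" and k0: "deriv f 0 = k 0"
    using Schwarz3[OF holf f0] by blast
  have knz: "k z \<noteq> 0" if "cmod z < 1" for z
    using k[OF that] fnz[OF that] k0 f1 by (cases "z = 0") auto
  define h where "h = (\<lambda>z. inverse (k z))"
  have "h holomorphic_on ball 0 1"
    unfolding h_def using knz by (intro holomorphic_intros holk) auto
  moreover have "h z \<noteq> 0" if "cmod z < 1" for z using knz[OF that] by (simp add: h_def)
  moreover have "h 0 = 1" using k0 f1 by (simp add: h_def)
  moreover have "f z * h z = z" if "cmod z < 1" for z
    using k[OF that] knz[OF that] by (simp add: h_def)
  moreover have "cmod (h z - z * deriv h z - 1) < 1" if z: "cmod z < 1" for z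
  proof -
    have dk: "(k has_field_derivative deriv k z) (at z)"
      using holk z by (intro holomorphic_derivI[of _ "ball 0 1"]) auto
    have "((\<lambda>z. z * k z) has_field_derivative k z + z * deriv k z) (at z)"
      using dk by (auto intro!: derivative_eq_intros)
    then have "(f has_field_derivative k z + z * deriv k z) (at z)"
      by (rule has_field_derivative_transform_within_open[of _ _ _ "ball 0 1"]) (use k z in auto)
    then have df: "deriv f z = k z + z * deriv k z" by (rule DERIV_imp_deriv)
    have "(h has_field_derivative - (deriv k z * (h z)\<^sup>2)) (at z)"
      unfolding h_def using dk knz[OF z]
      by (auto intro!: derivative_eq_intros simp: power2_eq_square)
    then have dh: "deriv h z = - (deriv k z * (h z)\<^sup>2)" by (rule DERIV_imp_deriv)
    have hz: "(if z = 0 then 1 else z / f z) = h z"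
      using k[OF z] k0 f1 by (simp add: h_def divide_inverse)
    have "h z * k z = 1" using knz[OF z] by (simp add: h_def)
    then have "h z - z * deriv h z - 1 = (h z)\<^sup>2 * deriv f z - 1"
      unfolding dh df by (simp add: power2_eq_square algebra_simps)
    then show ?thesis using U[OF z] unfolding hz by simp
  qed
  ultimately show ?thesis by (rule that)
qed

lemma fps_mult_low_order_coefficients:
  fixes F G :: "complex fps"
  shows "fps_nth (F * G) 1 = fps_nth F 0 * fps_nth G 1 + fps_nth F 1 * fps_nth G 0"
    and "fps_nth (F * G) 2 = fps_nth F 0 * fps_nth G 2 + fps_nth F 1 * fps_nth G 1
      + fps_nth F 2 * fps_nth G 0"
    and "fps_nth (F * G) 3 = fps_nth F 0 * fps_nth G 3 + fps_nth F 1 * fps_nth G 2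
      + fps_nth F 2 * fps_nth G 1 + fps_nth F 3 * fps_nth G 0"
    and "fps_nth (F * G) 4 = fps_nth F 0 * fps_nth G 4 + fps_nth F 1 * fps_nth G 3
      + fps_nth F 2 * fps_nth G 2 + fps_nth F 3 * fps_nth G 1 + fps_nth F 4 * fps_nth G 0"
    and "fps_nth (F * G) 5 = fps_nth F 0 * fps_nth G 5 + fps_nth F 1 * fps_nth G 4
      + fps_nth F 2 * fps_nth G 3 + fps_nth F 3 * fps_nth G 2 + fps_nth F 4 * fps_nth G 1
      + fps_nth F 5 * fps_nth G 0"
  by (simp_all add: fps_mult_nth eval_nat_numeral)

text \<open>
  In \<open>h - z h' - 1\<close> the coefficient of \<open>z\<^sup>n\<close> is \<open>(1 - n)\<close> times that of \<open>h\<close>, so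
  \<open>-c\<^sub>1, -c\<^sub>2, -c\<^sub>3\<close> are the coefficients of \<open>h\<close> of orders 2, 3, 4. The formulas for \<open>a\<^sub>3, a\<^sub>4, a\<^sub>5\<close>
  come from comparing coefficients in \<open>f h = z\<close>, and the inequalities are the Schur bounds for the
  quotient \<open>g\<close> of \<open>h - z h' - 1\<close> by \<open>z\<^sup>2\<close>.
\<close>

lemma class_U_coefficient_relations:
  assumes U: "f \<in> class_U"
  defines "a \<equiv> \<lambda>n. fps_nth (fps_expansion f 0) n"
  obtains c1 c2 c3 where
    "a 1 = 1" "a 3 = (a 2)\<^sup>2 + c1" "a 4 = (a 2)^3 + 2 * a 2 * c1 + c2"
    "a 5 = (a 2)^4 + 3 * (a 2)\<^sup>2 * c1 + 2 * a 2 * c2 + c1\<^sup>2 + c3"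
    "cmod c1 \<le> 1" "2 * cmod c2 \<le> 1 - (cmod c1)\<^sup>2"
    "3 * cmod c3 \<le> 1 - (cmod c1)\<^sup>2 - 4 * (cmod c2)\<^sup>2 / (1 + cmod c1)"
proof -
  have holf: "f holomorphic_on ball 0 1" using U by (simp add: class_U_def class_A_def)
  obtain h where holh: "h holomorphic_on ball 0 1" and h0: "h 0 = 1"
    and fh: "\<And>z. cmod z < 1 \<Longrightarrow> f z * h z = z"
    and W: "\<And>z. cmod z < 1 \<Longrightarrow> cmod (h z - z * deriv h z - 1) < 1"
    using class_U_reciprocal[OF U] by metis
  define A where "A = fps_expansion f 0"
  define H where "H = fps_expansion h 0"
  have A: "f has_fps_expansion A" unfolding A_def by (rule disc_expansion[OF holf])
  have H: "h has_fps_expansion H" unfolding H_def by (rule disc_expansion[OF holh])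
  have AH: "A * H = fps_X"
    by (rule disc_expansion_eq[OF has_fps_expansion_mult[OF A H] has_fps_expansion_fps_X fh])
  define \<omega> where "\<omega> = (\<lambda>z. h z - z * deriv h z - 1)"
  have hol_om: "\<omega> holomorphic_on ball 0 1"
    unfolding \<omega>_def by (intro holomorphic_intros holh) auto
  have om: "\<omega> has_fps_expansion H - fps_X * fps_deriv H - 1"
    unfolding \<omega>_def by (intro fps_expansion_intros H)
  have om_le: "cmod (\<omega> z) \<le> 1" if "cmod z < 1" for z using W[OF that] by (simp add: \<omega>_def)
  have om0: "\<omega> 0 = 0" by (simp add: \<omega>_def h0)
  obtain g1 where g1: "g1 holomorphic_on ball 0 1" "\<And>z. cmod z < 1 \<Longrightarrow> cmod (g1 z) \<le> 1"
      "\<And>z. cmod z < 1 \<Longrightarrow> \<omega> z = z * g1 z"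
    using schwarz_quotient[OF hol_om om_le om0] by blast
  define G1 where "G1 = fps_expansion g1 0"
  have G1: "g1 has_fps_expansion G1" unfolding G1_def by (rule disc_expansion[OF g1(1)])
  have rel1: "H - fps_X * fps_deriv H - 1 = fps_X * G1"
    by (rule disc_expansion_eq[OF om has_fps_expansion_mult[OF has_fps_expansion_fps_X G1] g1(3)])
  have "g1 0 = 0"
    using arg_cong[OF rel1, of "\<lambda>F. fps_nth F 1"] fps_nth_fps_expansion[OF G1, of 0] by simp
  then obtain g where g: "g holomorphic_on ball 0 1" "\<And>z. cmod z < 1 \<Longrightarrow> cmod (g z) \<le> 1"
      "\<And>z. cmod z < 1 \<Longrightarrow> g1 z = z * g z"
    using schwarz_quotient[OF g1(1,2)] by blast
  define G where "G = fps_expansion g 0"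
  have G: "g has_fps_expansion G" unfolding G_def by (rule disc_expansion[OF g(1)])
  have rel2: "G1 = fps_X * G"
    by (rule disc_expansion_eq[OF G1 has_fps_expansion_mult[OF has_fps_expansion_fps_X G] g(3)])
  have rel: "H - fps_X * fps_deriv H - 1 = fps_X * (fps_X * G)"
    using rel1 rel2 by simp
  have H0: "fps_nth H 0 = 1" using fps_nth_fps_expansion[OF H, of 0] h0 by simp
  have H2: "fps_nth H 2 = - fps_nth G 0"
    using arg_cong[OF rel[symmetric], of "\<lambda>F. fps_nth F 2"] by (simp add: eval_nat_numeral algebra_simps)
  have H3: "fps_nth H 3 = - (fps_nth G 1 / 2)"
    using arg_cong[OF rel[symmetric], of "\<lambda>F. fps_nth F 3"] by (simp add: eval_nat_numeral algebra_simps)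
  have H4: "fps_nth H 4 = - (fps_nth G 2 / 3)"
    using arg_cong[OF rel[symmetric], of "\<lambda>F. fps_nth F 4"] by (simp add: eval_nat_numeral algebra_simps)
  have a_eq: "a n = fps_nth A n" for n by (simp add: a_def A_def)
  define c1 c2 c3 where "c1 = fps_nth G 0" and "c2 = fps_nth G 1 / 2" and "c3 = fps_nth G 2 / 3"
  note low = fps_mult_low_order_coefficients[of A H, unfolded AH a_eq[symmetric] H0 H2 H3 H4]
  have "fps_nth (A * H) 0 = 0" by (simp add: AH)
  then have a0: "a 0 = 0" using H0 by (simp add: a_eq)
  have a1: "a 1 = 1" using low(1) by (simp add: a0)
  have "a 2 + fps_nth H 1 = 0" using low(2) a1 by (simp add: a0 add.commute)
  then have H1: "fps_nth H 1 = - a 2" by (simp add: eq_neg_iff_add_eq_0 add.commute)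
  have a3: "a 3 = (a 2)\<^sup>2 + c1"
    using low(3) a1 H1 by (simp add: a0 c1_def power2_eq_square algebra_simps)
  have a4: "a 4 = a 2 * a 3 + a 2 * c1 + c2"
    using low(4) a1 H1 by (simp add: a0 c1_def c2_def algebra_simps)
  have a5: "a 5 = a 2 * a 4 + a 3 * c1 + a 2 * c2 + c3"
    using low(5) a1 H1 by (simp add: a0 c1_def c2_def c3_def algebra_simps)
  have "a 4 = (a 2)^3 + 2 * a 2 * c1 + c2"
    unfolding a4 a3 by (simp add: power2_eq_square power3_eq_cube algebra_simps)
  moreover have "a 5 = (a 2)^4 + 3 * (a 2)\<^sup>2 * c1 + 2 * a 2 * c2 + c1\<^sup>2 + c3"
    unfolding a5 a4 a3 by (simp add: power2_eq_square power4_eq_xxxx algebra_simps)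
  moreover have "cmod c1 \<le> 1" unfolding c1_def by (rule norm_fps_nth_le_1[OF g(1,2) G])
  moreover have "2 * cmod c2 \<le> 1 - (cmod c1)\<^sup>2"
    using schur_coefficient_bound_1[OF g(1,2) G] by (simp add: c1_def c2_def norm_divide)
  moreover have "3 * cmod c3 \<le> 1 - (cmod c1)\<^sup>2 - 4 * (cmod c2)\<^sup>2 / (1 + cmod c1)"
    using schur_coefficient_bound_2[OF g(1,2) G]
    by (simp add: c1_def c2_def c3_def norm_divide power_divide)
  ultimately show ?thesis using a1 a3 by (intro that)
qed

text \<open>
  Since \<open>f(z) = z P(z)\<^sup>2\<close> and the coefficients of \<open>P\<close> are bounded by 1, the Cauchy product
  expresses \<open>a\<^sub>n\<close> as a sum of \<open>n\<close> terms of modulus at most 1.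
\<close>

lemma class_U_coefficient_bound:
  assumes U: "f \<in> class_U"
  shows "cmod (fps_nth (fps_expansion f 0) n) \<le> n"
proof -
  have holf: "f holomorphic_on ball 0 1" using U by (simp add: class_U_def class_A_def)
  obtain h where holh: "h holomorphic_on ball 0 1" and hnz: "\<And>z. cmod z < 1 \<Longrightarrow> h z \<noteq> 0"
    and h0: "h 0 = 1" and fh: "\<And>z. cmod z < 1 \<Longrightarrow> f z * h z = z"
    and W: "\<And>z. cmod z < 1 \<Longrightarrow> cmod (h z - z * deriv h z - 1) < 1"
    using class_U_reciprocal[OF U] by metis
  obtain \<phi> where phi: "\<phi> holomorphic_on ball 0 1" "\<phi> 0 = 0"
    and phi_less: "\<And>z. cmod z < 1 \<Longrightarrow> cmod (\<phi> z) < 1"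
    and heq: "\<And>z. cmod z < 1 \<Longrightarrow> h z = (1 - \<phi> z)\<^sup>2"
    using sqrt_minus_one_in_disc[OF holh hnz h0 W] by metis
  define P where "P = (\<lambda>z. inverse (1 - \<phi> z))"
  define p where "p = fps_expansion P 0"
  have nz: "1 - \<phi> z \<noteq> 0" if "cmod z < 1" for z using hnz[OF that] heq[OF that] by auto
  have holP: "P holomorphic_on ball 0 1"
    unfolding P_def using nz by (intro holomorphic_intros phi) auto
  have p: "P has_fps_expansion p" unfolding p_def by (rule disc_expansion[OF holP])
  have "Re (P z) > 1/2" if "cmod z < 1" for z
    using half_lt_Re_inverse[of "1 - \<phi> z"] phi_less[OF that] by (simp add: P_def)
  then have p_le: "cmod (fps_nth p i) \<le> 1" for i
    using half_plane_coefficient_bound[OF holP _ _ p] by (simp add: P_def phi(2))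
  have "fps_expansion f 0 = fps_X * (p * p)"
  proof (rule disc_expansion_eq[OF disc_expansion[OF holf]])
    show "(\<lambda>z. z * (P z * P z)) has_fps_expansion fps_X * (p * p)"
      by (intro fps_expansion_intros p)
    show "f z = z * (P z * P z)" if "cmod z < 1" for z
    proof -
      have "P z * P z * h z = 1"
        using nz[OF that] unfolding heq[OF that] P_def power2_eq_square
        by (metis inverse_mult_distrib left_inverse mult_eq_0_iff)
      then have "f z = (f z * h z) * (P z * P z)" by (simp add: mult_ac)
      then show ?thesis using fh[OF that] by simp
    qed
  qed
  then have "fps_nth (fps_expansion f 0) n = (if n = 0 then 0 else fps_nth (p * p) (n - 1))"
    by simp
  moreover have "cmod (fps_nth (p * p) m) \<le> real (Suc m)" for m
  proof -
    have "cmod (fps_nth (p * p) m) \<le> (\<Sum>i=0..m. cmod (fps_nth p i * fps_nth p (m - i)))"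
      unfolding fps_mult_nth by (rule norm_sum)
    also have "\<dots> \<le> (\<Sum>i=0..m. 1)"
      unfolding norm_mult by (intro sum_mono mult_le_one p_le norm_ge_zero)
    finally show ?thesis by simp
  qed
  from this[of "n - 1"] show ?thesis using calculation by (cases n) auto
qed

section \<open>Hankel determinants\<close>

text \<open>
  The quartic is the majorant of \<open>hankel_majorant_bound\<close> on its boundary curve
  \<open>2 y = 1 - x\<^sup>2\<close>. Its maximum on the unit interval, about \<open>1.4846575\<close>, is attained near
  \<open>x = 0.6618235\<close>. At this point \<open>m\<close> the derivative is almost zero, and the remainder of the
  first-order Taylor expansion is \<open>-(x - m)\<^sup>2\<close> times a factor that is nonnegative on the interval.
\<close>

lemma quartic_bound:
  fixes x :: real
  assumes "0 \<le> x" "x \<le> 1"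
  shows "1/4 + 3 * x - x\<^sup>2 / 2 - 2 * x^3 + x^4 / 4 \<le> 148466 / 100000"
proof -
  define q where "q = (\<lambda>x::real. 1/4 + 3 * x - x\<^sup>2 / 2 - 2 * x^3 + x^4 / 4)"
  define m :: real where "m = 6618235 / 10000000"
  have taylor: "q x = q m + (3 - m - 6 * m\<^sup>2 + m^3) * (x - m)
      - (x - m)\<^sup>2 * (1/2 + 2 * x + 4 * m - (x\<^sup>2 + 2 * m * x + 3 * m\<^sup>2) / 4)"
    unfolding q_def by (simp add: field_simps power2_eq_square power3_eq_cube power4_eq_xxxx)
  have "x\<^sup>2 \<le> 1" using assms by (simp add: power_le_one)
  then have "0 \<le> 1/2 + 2 * x + 4 * m - (x\<^sup>2 + 2 * m * x + 3 * m\<^sup>2) / 4"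
    using assms by (simp add: m_def power2_eq_square)
  then have "0 \<le> (x - m)\<^sup>2 * (1/2 + 2 * x + 4 * m - (x\<^sup>2 + 2 * m * x + 3 * m\<^sup>2) / 4)"
    by (rule mult_nonneg_nonneg[OF zero_le_power2])
  then have "q x \<le> q m + (3 - m - 6 * m\<^sup>2 + m^3) * (x - m)" using taylor by simp
  also have "\<dots> \<le> 1484658 / 1000000 + 1 / 1000000"
  proof (rule add_mono)
    show "q m \<le> 1484658 / 1000000"
      by (simp add: q_def m_def power2_eq_square power3_eq_cube power4_eq_xxxx)
    have "\<bar>3 - m - 6 * m\<^sup>2 + m^3\<bar> \<le> 1 / 1000000"
      by (simp add: m_def power2_eq_square power3_eq_cube)
    moreover have "\<bar>x - m\<bar> \<le> 1" using assms by (simp add: m_def abs_if)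
    ultimately have "\<bar>3 - m - 6 * m\<^sup>2 + m^3\<bar> * \<bar>x - m\<bar> \<le> 1 / 1000000 * 1"
      by (intro mult_mono) simp_all
    then show "(3 - m - 6 * m\<^sup>2 + m^3) * (x - m) \<le> 1 / 1000000"
      unfolding abs_mult[symmetric] by linarith
  qed
  finally have "q x \<le> 148466 / 100000" by simp
  then show ?thesis by (simp add: q_def)
qed

text \<open>
  With \<open>x = \<bar>c\<^sub>1\<bar>\<close> and \<open>y = \<bar>c\<^sub>2\<bar>\<close>, the left-hand side majorises the Hankel determinant
  \<open>a\<^sub>3 a\<^sub>5 - a\<^sub>4\<^sup>2\<close>. For fixed \<open>x\<close> it is concave in \<open>y\<close>. If \<open>x \<le> 2/5\<close>, already its unconstrained
  maximum over \<open>y\<close> is small. If \<open>x \<ge> 2/5\<close>, then \<open>x\<^sup>2 - 8 x + 3 \<le> 0\<close>, which says that it increases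
  in \<open>y\<close> up to the largest admissible value \<open>z = (1 - x\<^sup>2) / 2\<close>; there it equals the quartic of
  \<open>quartic_bound\<close>.
\<close>

lemma hankel_majorant_bound:
  fixes x y :: real
  assumes x: "0 \<le> x" "x \<le> 1" and y: "0 \<le> y" "2 * y \<le> 1 - x\<^sup>2"
  shows "1 - x\<^sup>2 - 4 * y\<^sup>2 / (1 + x) + 4 * x * y + x^3 + y\<^sup>2 \<le> 148466 / 100000"
proof -
  define K where "K = (3 - x) / (1 + x)"
  have K0: "0 \<le> K" using x by (simp add: K_def)
  have Kx: "K * (1 + x) = 3 - x" using x by (simp add: K_def)
  have "4 / (1 + x) = K + 1" using x by (simp add: K_def field_simps)
  then have "4 * y\<^sup>2 / (1 + x) = (K + 1) * y\<^sup>2" by (metis times_divide_eq_left)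
  then have lhs: "1 - x\<^sup>2 - 4 * y\<^sup>2 / (1 + x) + 4 * x * y + x^3 + y\<^sup>2
      = 1 - x\<^sup>2 + x^3 + (4 * x * y - K * y\<^sup>2)"
    by (simp add: algebra_simps)
  show ?thesis
  proof (cases "x \<le> 2/5")
    case True
    have "13/7 \<le> K" using True x by (simp add: K_def field_simps)
    then have "13/7 * y\<^sup>2 \<le> K * y\<^sup>2" by (intro mult_right_mono) auto
    moreover have "4 * x * y - 13/7 * y\<^sup>2 \<le> 28/13 * x\<^sup>2"
      using zero_le_power2[of "14 * x - 13 * y"] by (simp add: power2_eq_square algebra_simps)
    moreover have "x\<^sup>2 \<le> (2/5)\<^sup>2" "x^3 \<le> (2/5)^3" using True x by (intro power_mono; simp)+
    ultimately show ?thesis unfolding lhs by (simp add: power2_eq_square power3_eq_cube)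
  next
    case False
    define z where "z = (1 - x\<^sup>2) / 2"
    have z: "2 * z = (1 + x) * (1 - x)" by (simp add: z_def power2_eq_square field_simps)
    have yz: "y \<le> z" using y by (simp add: z_def)
    have "K * (z + y) \<le> K * (2 * z)" using K0 yz by (intro mult_left_mono) auto
    also have "\<dots> = (3 - x) * (1 - x)" unfolding z using Kx by (metis mult.assoc)
    also have "\<dots> \<le> 4 * x"
    proof -
      have "(x - 2/5) * (x - 1) \<le> 0" using False x by (intro mult_nonneg_nonpos) auto
      then have "x * x \<le> 7/5 * x - 2/5" by (simp add: field_simps)
      moreover have "(3 - x) * (1 - x) = x * x - 4 * x + 3" by (simp add: algebra_simps)
      ultimately show ?thesis using False by linarith
    qed
    finally have "0 \<le> (z - y) * (4 * x - K * (z + y))" using yz by simp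
    then have "4 * x * y - K * y\<^sup>2 \<le> 4 * x * z - K * z\<^sup>2"
      by (simp add: power2_eq_square algebra_simps)
    also have "K * z\<^sup>2 = (1 - x) * (3 - x) * (1 - x\<^sup>2) / 4"
    proof -
      have "K * z\<^sup>2 = (K * (2 * z)) * (2 * z) / 4" by (simp add: power2_eq_square)
      also have "\<dots> = (K * (1 + x)) * (1 - x) * ((1 + x) * (1 - x)) / 4" unfolding z by simp
      finally show ?thesis unfolding Kx by (simp add: power2_eq_square algebra_simps)
    qed
    finally have "1 - x\<^sup>2 + x^3 + (4 * x * y - K * y\<^sup>2)
        \<le> 1/4 + 3 * x - x\<^sup>2 / 2 - 2 * x^3 + x^4 / 4"
      by (simp add: z_def power2_eq_square power3_eq_cube power4_eq_xxxx field_simps)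
    then show ?thesis unfolding lhs using quartic_bound[OF x] by linarith
  qed
qed

lemma class_U_fekete_szego:
  assumes U: "f \<in> class_U"
  defines "a \<equiv> \<lambda>n. fps_nth (fps_expansion f 0) n"
  shows "cmod (a 3 - (a 2)\<^sup>2) \<le> 1"
  using class_U_coefficient_relations[OF U] unfolding a_def by (metis add_diff_cancel_left')

text \<open>
  In the variables of \<open>class_U_coefficient_relations\<close> this is \<open>a\<^sub>2 c\<^sub>2 - c\<^sub>1\<^sup>2\<close>: the high powers of \<open>a\<^sub>2\<close> cancel.
\<close>

lemma class_U_hankel_2:
  assumes U: "f \<in> class_U"
  defines "a \<equiv> \<lambda>n. fps_nth (fps_expansion f 0) n"
  shows "cmod (a 2 * a 4 - (a 3)\<^sup>2) \<le> 1"
proof -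
  obtain c1 c2 where a: "a 3 = (a 2)\<^sup>2 + c1" "a 4 = (a 2)^3 + 2 * a 2 * c1 + c2"
    and c: "2 * cmod c2 \<le> 1 - (cmod c1)\<^sup>2"
    using class_U_coefficient_relations[OF U] unfolding a_def by metis
  have a2: "cmod (a 2) \<le> 2" using class_U_coefficient_bound[OF U, of 2] by (simp add: a_def)
  have "a 2 * a 4 - (a 3)\<^sup>2 = a 2 * c2 - c1\<^sup>2"
    unfolding a by (simp add: power2_eq_square power3_eq_cube algebra_simps)
  then have "cmod (a 2 * a 4 - (a 3)\<^sup>2) \<le> cmod (a 2) * cmod c2 + (cmod c1)\<^sup>2"
    by (metis norm_triangle_ineq4 norm_mult norm_power)
  also have "\<dots> \<le> 2 * cmod c2 + (cmod c1)\<^sup>2"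
    using a2 by (intro add_right_mono mult_right_mono) auto
  finally show ?thesis using c by linarith
qed

text \<open>
  The powers of \<open>a\<^sub>2\<close> cancel again, except for \<open>a\<^sub>2\<^sup>2 c\<^sub>3\<close>. Combining this term with
  \<open>c\<^sub>1 c\<^sub>3\<close> into \<open>a\<^sub>3 c\<^sub>3\<close> permits the bound \<open>\<bar>a\<^sub>3\<bar> \<le> 3\<close> in place of the weaker
  \<open>\<bar>a\<^sub>2\<bar>\<^sup>2 + \<bar>c\<^sub>1\<bar> \<le> 5\<close>.
\<close>

lemma class_U_hankel_3:
  assumes U: "f \<in> class_U"
  defines "a \<equiv> \<lambda>n. fps_nth (fps_expansion f 0) n"
  shows "cmod (a 3 * a 5 - (a 4)\<^sup>2) \<le> 148466 / 100000"
proof -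
  obtain c1 c2 c3 where a: "a 3 = (a 2)\<^sup>2 + c1" "a 4 = (a 2)^3 + 2 * a 2 * c1 + c2"
    "a 5 = (a 2)^4 + 3 * (a 2)\<^sup>2 * c1 + 2 * a 2 * c2 + c1\<^sup>2 + c3"
    and c: "cmod c1 \<le> 1" "2 * cmod c2 \<le> 1 - (cmod c1)\<^sup>2"
    "3 * cmod c3 \<le> 1 - (cmod c1)\<^sup>2 - 4 * (cmod c2)\<^sup>2 / (1 + cmod c1)"
    using class_U_coefficient_relations[OF U] unfolding a_def by metis
  have a2: "cmod (a 2) \<le> 2" using class_U_coefficient_bound[OF U, of 2] by (simp add: a_def)
  have a3: "cmod (a 3) \<le> 3" using class_U_coefficient_bound[OF U, of 3] by (simp add: a_def)
  have triangle: "cmod (p - q + r - s) \<le> cmod p + cmod q + cmod r + cmod s" for p q r s :: complex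
    using norm_triangle_ineq4[of "p - q + r" s] norm_triangle_ineq[of "p - q" r]
      norm_triangle_ineq4[of p q] by linarith
  have "a 3 * a 5 - (a 4)\<^sup>2 = ((a 2)\<^sup>2 + c1) * c3 - 2 * a 2 * c1 * c2 + c1^3 - c2\<^sup>2"
    unfolding a by (simp add: power2_eq_square power3_eq_cube power4_eq_xxxx algebra_simps)
  also have "\<dots> = a 3 * c3 - 2 * a 2 * c1 * c2 + c1^3 - c2\<^sup>2" by (simp add: a(1))
  finally have "cmod (a 3 * a 5 - (a 4)\<^sup>2)
      \<le> cmod (a 3 * c3) + cmod (2 * a 2 * c1 * c2) + cmod (c1^3) + cmod (c2\<^sup>2)"
    using triangle by simp
  also have "\<dots> = cmod (a 3) * cmod c3 + 2 * cmod (a 2) * (cmod c1 * cmod c2)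
      + (cmod c1)^3 + (cmod c2)\<^sup>2"
    by (simp add: norm_mult norm_power)
  also have "\<dots> \<le> 3 * cmod c3 + 2 * 2 * (cmod c1 * cmod c2) + (cmod c1)^3 + (cmod c2)\<^sup>2"
    using a2 a3 by (intro add_mono mult_mono order_refl) auto
  also have "\<dots> \<le> 1 - (cmod c1)\<^sup>2 - 4 * (cmod c2)\<^sup>2 / (1 + cmod c1)
      + 4 * cmod c1 * cmod c2 + (cmod c1)^3 + (cmod c2)\<^sup>2"
    using c(3) by simp
  also have "\<dots> \<le> 148466 / 100000"
    using c by (intro hankel_majorant_bound) auto
  finally show ?thesis .
qed

section \<open>Toeplitz determinants\<close>

lemma toeplitz_det_2:
  defines "a \<equiv> \<lambda>f n. fps_nth (fps_expansion f 0) n"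
  shows "toeplitz_det 2 n f = (a f n)\<^sup>2 - (a f (n + 1))\<^sup>2"
  unfolding toeplitz_det_def a_def
  by (subst laplace_expansion_row[of _ 2 0])
    (auto simp: numeral_2_eq_2 cofactor_def mat_delete_def det_single power2_eq_square)

lemma toeplitz_det_3:
  defines "a \<equiv> \<lambda>f n. fps_nth (fps_expansion f 0) n"
  shows "toeplitz_det 3 n f = (a f n - a f (n + 2)) *
    ((a f n)\<^sup>2 - 2 * (a f (n + 1))\<^sup>2 + a f n * a f (n + 2))"
proof -
  have det2: "Determinant.det B = B $$ (0,0) * B $$ (1,1) - B $$ (0,1) * B $$ (1,0)"
    if "B \<in> carrier_mat 2 2" for B :: "complex mat"
    using that by (subst laplace_expansion_row[of _ 2 0])
      (auto simp: numeral_2_eq_2 cofactor_def mat_delete_def det_single)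
  show ?thesis
    unfolding toeplitz_det_def a_def
    by (subst laplace_expansion_row[of _ 3 0])
      (auto simp: cofactor_def mat_delete_def det2 power2_eq_square algebra_simps eval_nat_numeral)
qed

lemma norm_diff_squares_le:
  fixes u v :: complex
  assumes "cmod u \<le> r" "cmod v \<le> s"
  shows "cmod (u\<^sup>2 - v\<^sup>2) \<le> r\<^sup>2 + s\<^sup>2"
proof -
  have "cmod (u\<^sup>2 - v\<^sup>2) \<le> cmod (u\<^sup>2) + cmod (v\<^sup>2)" by (rule norm_triangle_ineq4)
  also have "\<dots> \<le> r\<^sup>2 + s\<^sup>2"
    unfolding norm_power using assms by (intro add_mono power_mono) auto
  finally show ?thesis .
qed

text \<open>
  The point is to split off the Hankel determinant \<open>a c - b\<^sup>2\<close>, which is far smaller than the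
  triangle inequality for the separate terms would give.
\<close>

lemma norm_toeplitz_det_3_le:
  assumes "cmod a \<le> r" "cmod b \<le> s" "cmod c \<le> t" "cmod (a * c - b\<^sup>2) \<le> H"
  shows "cmod ((a - c) * (a\<^sup>2 - 2 * b\<^sup>2 + a * c)) \<le> (r + t) * (r\<^sup>2 + s\<^sup>2 + H)"
proof -
  have "cmod (a - c) \<le> r + t" using norm_triangle_ineq4[of a c] assms by linarith
  moreover have "cmod ((a\<^sup>2 - b\<^sup>2) + (a * c - b\<^sup>2)) \<le> (r\<^sup>2 + s\<^sup>2) + H"
    using assms by (intro norm_triangle_mono norm_diff_squares_le)
  moreover have "(a\<^sup>2 - b\<^sup>2) + (a * c - b\<^sup>2) = a\<^sup>2 - 2 * b\<^sup>2 + a * c" by simp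
  moreover have "0 \<le> r + t" using assms norm_ge_zero order_trans by (metis add_nonneg_nonneg)
  ultimately show ?thesis unfolding norm_mult by (intro mult_mono) auto
qed

text \<open>
  For the Koebe function rotated by a right angle, \<open>h(z) = (1 - \<i> z)\<^sup>2\<close>, so that
  \<open>h - z h' - 1 = z\<^sup>2\<close>.
\<close>

lemma rotated_koebe_in_class_U:
  obtains f where "f \<in> class_U"
    and "fps_nth (fps_expansion f 0) 1 = 1" and "fps_nth (fps_expansion f 0) 2 = 2 * \<i>"
    and "fps_nth (fps_expansion f 0) 3 = -3" and "fps_nth (fps_expansion f 0) 4 = -4 * \<i>"
proof -
  define f where "f = (\<lambda>z. z / (1 - \<i> * z)\<^sup>2)"
  have nz: "1 - \<i> * z \<noteq> 0" if "cmod z < 1" for z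
  proof
    assume "1 - \<i> * z = 0"
    then have "cmod (\<i> * z) = 1" by simp
    then show False using that by (simp add: norm_mult)
  qed
  have df: "(f has_field_derivative (1 + \<i> * z) / (1 - \<i> * z)^3) (at z)" if z: "cmod z < 1" for z
  proof -
    define u where "u = 1 - \<i> * z"
    have "((\<lambda>z. (1 - \<i> * z)\<^sup>2) has_field_derivative - (2 * \<i> * u)) (at z)"
      by (auto intro!: derivative_eq_intros simp: u_def)
    then have "(f has_field_derivative (1 * u\<^sup>2 - z * - (2 * \<i> * u)) / (u\<^sup>2 * u\<^sup>2)) (at z)"
      unfolding f_def u_def using nz[OF z] by (intro DERIV_divide DERIV_ident) auto
    also have "1 * u\<^sup>2 - z * - (2 * \<i> * u) = u * (1 + \<i> * z)"
      by (simp add: u_def power2_eq_square algebra_simps)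
    also have "u\<^sup>2 * u\<^sup>2 = u * u^3" by (simp add: power2_eq_square power3_eq_cube)
    also have "u * (1 + \<i> * z) / (u * u^3) = (1 + \<i> * z) / u^3"
      using nz[OF z] by (simp add: u_def)
    finally show ?thesis by (simp add: u_def)
  qed
  have hol: "f holomorphic_on ball 0 1"
    unfolding f_def using nz by (intro holomorphic_intros) auto
  have "f \<in> class_U"
    unfolding class_U_def class_A_def
  proof (intro CollectI conjI ballI)
    show "f holomorphic_on ball 0 1" by (rule hol)
    show "f 0 = 0" by (simp add: f_def)
    show "deriv f 0 = 1" using DERIV_imp_deriv[OF df[of 0]] by simp
    fix z :: complex assume "z \<in> ball 0 1"
    then have z: "cmod z < 1" by simp
    show "z \<noteq> 0 \<longrightarrow> f z \<noteq> 0" using nz[OF z] by (simp add: f_def)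
    have "(if z = 0 then 1 else z / f z)\<^sup>2 * deriv f z - 1
        = ((1 - \<i> * z)\<^sup>2)\<^sup>2 * ((1 + \<i> * z) / (1 - \<i> * z)^3) - 1"
      using DERIV_imp_deriv[OF df[OF z]] by (simp add: f_def)
    also have "\<dots> = (1 - \<i> * z) * (1 + \<i> * z) - 1"
      using nz[OF z] by (simp add: divide_simps power2_eq_square power3_eq_cube)
    also have "\<dots> = z\<^sup>2" by (simp add: power2_eq_square algebra_simps)
    finally show "cmod ((if z = 0 then 1 else z / f z)\<^sup>2 * deriv f z - 1) < 1"
      using z by (simp add: norm_power power_less_one_iff)
  qed
  define A where "A = fps_expansion f 0"
  define Q :: "complex fps" where "Q = 1 - fps_const (2 * \<i>) * fps_X - fps_X ^ 2"
  have "A * Q = fps_X"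
  proof (rule disc_expansion_eq)
    show "(\<lambda>z. f z * (1 - 2 * \<i> * z - z ^ 2)) has_fps_expansion A * Q"
      unfolding A_def Q_def by (intro fps_expansion_intros disc_expansion[OF hol])
    show "(\<lambda>z. z) has_fps_expansion fps_X" by (rule has_fps_expansion_fps_X)
    fix z :: complex assume z: "cmod z < 1"
    have "1 - 2 * \<i> * z - z ^ 2 = (1 - \<i> * z)\<^sup>2"
      by (simp add: power2_eq_square algebra_simps)
    then show "f z * (1 - 2 * \<i> * z - z ^ 2) = z" using nz[OF z] by (simp add: f_def)
  qed
  note low = fps_mult_low_order_coefficients[of A Q, unfolded this]
  have Q: "fps_nth Q 0 = 1" "fps_nth Q 1 = - 2 * \<i>" "fps_nth Q 2 = - 1"
      "fps_nth Q 3 = 0" "fps_nth Q 4 = 0"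
    by (simp_all add: Q_def fps_X_power_nth)
  have "fps_nth (A * Q) 0 = 0" by (simp add: \<open>A * Q = fps_X\<close>)
  then have A0: "fps_nth A 0 = 0" using Q(1) by simp
  have A1: "fps_nth A 1 = 1" using low(1) Q by (simp add: A0)
  have A2: "fps_nth A 2 = 2 * \<i>" using low(2) by (simp add: A0 Q A1 del: One_nat_def)
  have A3: "fps_nth A 3 = -3" using low(3) by (simp add: A0 Q A1 A2 eq_neg_iff_add_eq_0 add.commute del: One_nat_def)
  have A4: "fps_nth A 4 = -4 * \<i>" using low(4) by (simp add: A0 Q A1 A2 A3 eq_neg_iff_add_eq_0 add.commute del: One_nat_def)
  show ?thesis using \<open>f \<in> class_U\<close> A1 A2 A3 A4 unfolding A_def by (rule that)
qed

theorem theorem1: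
  shows "(\<forall>f \<in> class_U. cmod (toeplitz_det 2 2 f) \<le> 13) \<and>
         (\<forall>f \<in> class_U. cmod (toeplitz_det 2 3 f) \<le> 25) \<and>
         (\<forall>f \<in> class_U. cmod (toeplitz_det 3 1 f) \<le> 24) \<and>
         (\<forall>f \<in> class_U. cmod (toeplitz_det 3 2 f) \<le> 84) \<and>
         (\<exists>C::real. 211.8772 \<le> C \<and> C < 211.8773 \<and>
            (\<forall>f \<in> class_U. cmod (toeplitz_det 3 3 f) \<le> C)) \<and>
         (\<exists>f \<in> class_U. cmod (toeplitz_det 2 2 f) = 13) \<and>
         (\<exists>f \<in> class_U. cmod (toeplitz_det 2 3 f) = 25) \<and>
         (\<exists>f \<in> class_U. cmod (toeplitz_det 3 1 f) = 24) \<and>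
         (\<exists>f \<in> class_U. cmod (toeplitz_det 3 2 f) = 84)"
proof -
  define a where "a = (\<lambda>f n. fps_nth (fps_expansion f (0::complex)) n)"
  have T2: "toeplitz_det 2 n f = (a f n)\<^sup>2 - (a f (n + 1))\<^sup>2" for n f
    unfolding a_def by (rule toeplitz_det_2)
  have T3: "toeplitz_det 3 n f = (a f n - a f (n + 2)) *
    ((a f n)\<^sup>2 - 2 * (a f (n + 1))\<^sup>2 + a f n * a f (n + 2))" for n f
    unfolding a_def by (rule toeplitz_det_3)
  have idx: "(1::nat) + 1 = 2" "(1::nat) + 2 = 3" by simp_all
  have bounds: "cmod (toeplitz_det 2 2 f) \<le> 13" "cmod (toeplitz_det 2 3 f) \<le> 25"
    "cmod (toeplitz_det 3 1 f) \<le> 24" "cmod (toeplitz_det 3 2 f) \<le> 84"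
    "cmod (toeplitz_det 3 3 f) \<le> 8 * (25 + 148466 / 100000)" if U: "f \<in> class_U" for f
  proof -
    have a_le: "cmod (a f n) \<le> n" for n
      unfolding a_def by (rule class_U_coefficient_bound[OF U])
    have le: "cmod (a f 2) \<le> 2" "cmod (a f 3) \<le> 3" "cmod (a f 4) \<le> 4" "cmod (a f 5) \<le> 5"
      using a_le[of 2] a_le[of 3] a_le[of 4] a_le[of 5] by simp_all
    have a1: "a f 1 = 1"
      using class_U_coefficient_relations[OF U] unfolding a_def by metis
    show "cmod (toeplitz_det 2 2 f) \<le> 13"
      using norm_diff_squares_le[OF le(1,2)] by (simp add: T2)
    show "cmod (toeplitz_det 2 3 f) \<le> 25"
      using norm_diff_squares_le[OF le(2,3)] by (simp add: T2)
    have "toeplitz_det 3 1 f = (1 - a f 3) * (1 - (a f 2)\<^sup>2 + (a f 3 - (a f 2)\<^sup>2))"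
      unfolding T3[of 1 f] idx a1 by (simp add: algebra_simps)
    moreover have "cmod (1 - a f 3) \<le> 4"
      using norm_triangle_ineq4[of 1 "a f 3"] le by simp
    moreover have "cmod (1 - (a f 2)\<^sup>2 + (a f 3 - (a f 2)\<^sup>2)) \<le> (1\<^sup>2 + 2\<^sup>2) + 1"
      using norm_diff_squares_le[of 1 1 "a f 2" 2] le(1) class_U_fekete_szego[OF U]
      by (intro norm_triangle_mono) (simp_all add: a_def)
    ultimately show "cmod (toeplitz_det 3 1 f) \<le> 24"
      using mult_mono[of "cmod (1 - a f 3)" 4 "cmod (1 - (a f 2)\<^sup>2 + (a f 3 - (a f 2)\<^sup>2))" 6]
      by (simp add: norm_mult)
    have hankel: "cmod (a f 2 * a f 4 - (a f 3)\<^sup>2) \<le> 1"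
        "cmod (a f 3 * a f 5 - (a f 4)\<^sup>2) \<le> 148466 / 100000"
      unfolding a_def by (rule class_U_hankel_2[OF U], rule class_U_hankel_3[OF U])
    show "cmod (toeplitz_det 3 2 f) \<le> 84"
      using norm_toeplitz_det_3_le[OF le(1,2,3) hankel(1)]
      by (simp add: T3)
    show "cmod (toeplitz_det 3 3 f) \<le> 8 * (25 + 148466 / 100000)"
      using norm_toeplitz_det_3_le[OF le(2,3,4) hankel(2)]
      by (simp add: T3)
  qed
  obtain f where U: "f \<in> class_U" and f: "a f 1 = 1" "a f 2 = 2 * \<i>" "a f 3 = -3" "a f 4 = -4 * \<i>"
    unfolding a_def using rotated_koebe_in_class_U by blast
  have "toeplitz_det 2 2 f = -13" "toeplitz_det 2 3 f = 25"
      "toeplitz_det 3 1 f = 24" "toeplitz_det 3 2 f = - 84 * \<i>"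
    using T2[of 2 f] T2[of 3 f] T3[of 1 f, unfolded idx f] T3[of 2 f] f
    by (simp_all add: power_mult_distrib)
  then have "cmod (toeplitz_det 2 2 f) = 13" "cmod (toeplitz_det 2 3 f) = 25"
      "cmod (toeplitz_det 3 1 f) = 24" "cmod (toeplitz_det 3 2 f) = 84"
    by (simp_all add: norm_mult)
  moreover have "\<exists>C::real. 211.8772 \<le> C \<and> C < 211.8773 \<and>
      (\<forall>f \<in> class_U. cmod (toeplitz_det 3 3 f) \<le> C)"
    \<comment> \<open>\<open>8 (25 + 1.48466) = 211.87728\<close>\<close>
    by (rule exI[of _ "8 * (25 + 148466 / 100000)"]) (use bounds(5) in simp)
  ultimately show ?thesis using bounds U by blast
qed

end
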